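(* Let $\mathbb{K}$ be a field of characteristic $0$, let $\mathbb{F}$ be $\mathbb{K}[x]$ or $\mathbb{K}(x)$ with derivation $\partial/\partial x$, and let $\alpha\in\{+,-,\times,/\}$. Let $p\in\mathbb{F}[y^{(\infty)}]$ and $q\in\mathbb{F}[z^{(\infty)}]$ be differential polynomials of order $n$ and $m$, respectively. If $p$ and $q$ are both linear in their highest order terms (l.h.o.), then $$\mathfrak{o}_{\alpha}(p,q)\;\le\; m+n,$$ where $\mathfrak{o}_\alpha(p,q)$ is the minimal order of a non-zero differential polynomial in $w$ that can be derived from the dynamical model $\mathcal{M}_{\alpha(p,q)}$ (defined in the context). In particular, such a non-zero differential polynomial exists.
   Context: Differential polynomials: $\mathbb{F}[y^{(\infty)}]=\mathbb{F}[y,y',y'',\ldots]$ is the polynomial ring in infinitely many variables $y^{(j)}$ ($j\in\mathbb{N}$, $y^{(0)}=y$) with the derivation extending that of $\mathbb{F}$ and satisfying $(y^{(j)})'=y^{(j+1)}$; similarly for several differential indeterminates. The order of a non-zero differential polynomial is the largest $n$ such that $y^{(n)}$ occurs in it. A differential polynomial $p$ of order $n$ is linear in its highest order term (l.h.o.) if $y^{(n)}$ appears only linearly in $p$, i.e. $p$ has degree $1$ in $y^{(n)}$. In that case, the equation $p=0$ can be solved for $y^{(n)}$, giving $y^{(n)}=r_p(x,y,\ldots,y^{(n-1)})$ with $r_p$ a rational function over $\mathbb{K}$. For a set $S$ of differential polynomials, $\langle S\rangle^{(\infty)}$ is the ideal generated by all elements of $S$ and all their derivatives. For an ideal $I$ of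 a ring $R$ and $s\in R$, $I:s^\infty=\{r\in R\mid \exists k\in\mathbb{N}: s^k r\in I\}$. Dynamical model: a system $\mathcal{M}$ of the form $u_i'=A_i(u_1,\ldots,u_N)$ $(1\le i\le N)$, $w=B(u_1,\ldots,u_N)$, with $A_i,B\in\mathbb{K}(x)(u_1,\ldots,u_N)$. Its dimension is $N$. Let $Q$ be the common denominator of the system and write $A_i=a_i/Q$, $B=b/Q$ with $a_i,b,Q\in\mathbb{K}(x)[u_1,\ldots,u_N]$. Put $$I_{\mathcal{M}}=\langle Qu_1'-a_1,\ldots,Qu_N'-a_N,\;Qw-b\rangle^{(\infty)}:Q^\infty\;\subset\;\mathbb{K}(x)[u_1^{(\infty)},\ldots,u_N^{(\infty)},w^{(\infty)}].$$ The differential polynomials in $w$ derived from $\mathcal{M}$ are the elements of $I_{\mathcal{M}}\cap\mathbb{K}(x)[w^{(\infty)}]$. The model $\mathcal{M}_{\alpha(p,q)}$: let $p,q$ be l.h.o. of orders $n,m$, let $r_p$ be the rational function over $\mathbb{K}$ obtained by solving $p=0$ for $y^{(n)}$, so that $y^{(n)}=r_p(x,y,\ldots,y^{(n-1)})$, and let $r_q$ be the rational function over $\mathbb{K}$ obtained by solving $q=0$ for $z^{(m)}$, so that $z^{(m)}=r_q(x,z,\ldots,z^{(m-1)})$. Then $\mathcal{M}_{\alpha(p,q)}$ is the system in the $n+m$ indeterminates $u_1=y,\ldots,u_n=y^{(n-1)}$, $u_{n+1}=z,\ldots,u_{n+m}=z^{(m-1)}$ given by $$u_i'=u_{i+1}\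 (1\le i\le n-1),\quad u_n'=r_p(x,u_1,\ldots,u_n),$$ $$u_{n+i}'=u_{n+i+1}\ (1\le i\le m-1),\quad u_{n+m}'=r_q(x,u_{n+1},\ldots,u_{n+m}),$$ $$w=\alpha(u_1,u_{n+1}).$$ (If $n=0$ there are no state variables for $y$, and $u_1$ in the last equation is read as $y=r_p(x)$; similarly, if $m=0$, $u_{n+1}$ is read as $z=r_q(x)$, where for $\alpha=/$ one needs $r_q\ne0$ for the model to be defined.) Finally, $\mathfrak{o}_\alpha(p,q)$ is the minimal order of a non-zero element of $I_{\mathcal{M}_{\alpha(p,q)}}\cap\mathbb{K}(x)[w^{(\infty)}]$. *)

theory Defs
  imports
    "HOL-Library.Poly_Mapping"
    "HOL-Library.Extended_Nat"
    "HOL-Computational_Algebra.Polynomial"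
    "HOL-Computational_Algebra.Fraction_Field"
begin

text \<open>
  \<open>'k poly fract\<close> is the field $K(x)$.  A polynomial with coefficients in \<open>'c\<close> and variables in \<open>'v\<close>
  (finitely many occurring, but \<open>'v\<close> may be infinite) is a finitely supported map from power
  products \<open>'v \<Rightarrow>\<^sub>0 nat\<close> to \<open>'c\<close>, multiplied by convolution.
\<close>

type_synonym ('v, 'c) mpoly = "('v \<Rightarrow>\<^sub>0 nat) \<Rightarrow>\<^sub>0 'c"

text \<open>The variable \<open>(i, j)\<close> of a differential polynomial is the \<open>j\<close>-th derivative of the
  differential indeterminate \<open>i\<close>.\<close>

type_synonym ('i, 'c) dpoly = "('i \<times> nat, 'c) mpoly"

text \<open>$K(x)(u_1, u_2, \ldots)$, with \<open>i :: nat\<close> standing for $u_i$; indices start at 1.\<close>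

type_synonym 'k ratfun = "(nat, 'k poly fract) mpoly fract"

definition Const :: "'c \<Rightarrow> ('v, 'c::comm_ring_1) mpoly" where
  "Const c = Poly_Mapping.single 0 c"

definition Var :: "'v \<Rightarrow> ('v, 'c::comm_ring_1) mpoly" where
  "Var v = Poly_Mapping.single (Poly_Mapping.single v 1) 1"

definition indets :: "('v, 'c::zero) mpoly \<Rightarrow> 'v set" where
  "indets P = (\<Union>m\<in>Poly_Mapping.keys P. Poly_Mapping.keys m)"

definition degree_in :: "'v \<Rightarrow> ('v, 'c::zero) mpoly \<Rightarrow> nat" where
  "degree_in v P = Max (insert 0 ((\<lambda>m. Poly_Mapping.lookup m v) ` Poly_Mapping.keys P))"

definition coeffs_in :: "'c set \<Rightarrow> ('v, 'c::zero) mpoly \<Rightarrow> bool" where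
  "coeffs_in F P \<longleftrightarrow> (\<forall>m. Poly_Mapping.lookup P m \<in> F)"

text \<open>Evaluation: coefficients are mapped by \<open>h\<close>, variables by \<open>f\<close>.\<close>

definition eval_mpoly :: "('c \<Rightarrow> 'r) \<Rightarrow> ('v \<Rightarrow> 'r) \<Rightarrow> ('v, 'c::zero) mpoly \<Rightarrow> 'r::comm_ring_1" where
  "eval_mpoly h f P =
     (\<Sum>m\<in>Poly_Mapping.keys P.
        h (Poly_Mapping.lookup P m) * (\<Prod>v\<in>Poly_Mapping.keys m. f v ^ Poly_Mapping.lookup m v))"


text \<open>The derivation $\partial/\partial x$ of $K(x)$, by the quotient rule.\<close>

lift_definition fract_deriv :: "'k::field poly fract \<Rightarrow> 'k poly fract"
  is "\<lambda>(a, b). (pderiv a * b - a * pderiv b, b * b)"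
proof -
  fix r s :: "'k poly \<times> 'k poly"
  assume rs: "fractrel r s"
  obtain a b c d where r: "r = (a, b)" and s: "s = (c, d)"
    by fastforce
  from rs r s have nz: "b \<noteq> 0" "d \<noteq> 0" and eq: "a * d = c * b"
    by auto
  have "pderiv (a * d) = pderiv (c * b)"
    by (simp add: eq)
  then have "a * pderiv d + d * pderiv a = c * pderiv b + b * pderiv c"
    by (simp add: pderiv_mult)
  then have "(pderiv a * b - a * pderiv b) * (d * d) = (pderiv c * d - c * pderiv d) * (b * b)"
    using eq by algebra
  with nz r s show "fractrel (case r of (a, b) \<Rightarrow> (pderiv a * b - a * pderiv b, b * b))
      (case s of (a, b) \<Rightarrow> (pderiv a * b - a * pderiv b, b * b))"
    by simp
qed

lemma fract_deriv_Fract: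
  "b \<noteq> 0 \<Longrightarrow> fract_deriv (Fract a b) = Fract (pderiv a * b - a * pderiv b) (b * b)"
  by transfer simp

text \<open>The derivation of the differential polynomial ring extending that of the coefficients: a
  term $c\,m$ is mapped to $c' m + \sum_v c\, e_v\, (m / v)\, v'$, where $e_v$ is the exponent
  of $v$ in $m$ and $v'$ is \<open>(i, Suc j)\<close> for $v$ = \<open>(i, j)\<close>.\<close>

definition ddiff :: "('i, 'k::field poly fract) dpoly \<Rightarrow> ('i, 'k poly fract) dpoly" where
  "ddiff P =
     (\<Sum>m\<in>Poly_Mapping.keys P.
        Poly_Mapping.single m (fract_deriv (Poly_Mapping.lookup P m)) +
        (\<Sum>v\<in>Poly_Mapping.keys m.
           Poly_Mapping.single
             (m - Poly_Mapping.single v 1 + Poly_Mapping.single (fst v, Suc (snd v)) 1)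
             (of_nat (Poly_Mapping.lookup m v) * Poly_Mapping.lookup P m)))"

text \<open>No order is assigned to a polynomial without variables.\<close>

definition has_order :: "('i, 'c::zero) dpoly \<Rightarrow> nat \<Rightarrow> bool" where
  "has_order P n \<longleftrightarrow> n \<in> snd ` indets P \<and> (\<forall>j\<in>snd ` indets P. j \<le> n)"

text \<open>One differential indeterminate: \<open>((), j)\<close> is $y^{(j)}$.\<close>

definition lho :: "(unit, 'c::zero) dpoly \<Rightarrow> nat \<Rightarrow> bool" where
  "lho P n \<longleftrightarrow> has_order P n \<and> degree_in ((), n) P = 1"


definition ideal_gen :: "'r set \<Rightarrow> 'r set \<Rightarrow> 'r::comm_ring_1 set" where
  "ideal_gen R S = {\<Sum>s\<in>T. c s * s | T c. finite T \<and> T \<subseteq> S \<and> c ` T \<subseteq> R}"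

definition diff_ideal_gen ::
  "('i, 'k::field poly fract) dpoly set \<Rightarrow> ('i, 'k poly fract) dpoly set \<Rightarrow> ('i, 'k poly fract) dpoly set" where
  "diff_ideal_gen R S = ideal_gen R {(ddiff ^^ k) s | k s. s \<in> S}"

definition saturation :: "'r set \<Rightarrow> 'r set \<Rightarrow> 'r \<Rightarrow> 'r::comm_ring_1 set" where
  "saturation R I s = {r \<in> R. \<exists>k. s ^ k * r \<in> I}"


text \<open>The system $u_i' = A_i(u_1,\ldots,u_N)$ for $1 \le i \le N$, $w = B(u_1,\ldots,u_N)$; the
  values of \<open>rhs\<close> outside $\{1,\ldots,N\}$ are irrelevant.\<close>

record (overloaded) 'k dyn_model =
  dim :: nat
  rhs :: "nat \<Rightarrow> 'k ratfun"
  outp :: "'k ratfun"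

definition state_polys :: "nat \<Rightarrow> (nat, 'c::zero) mpoly set" where
  "state_polys N = {P. indets P \<subseteq> {1..N}}"

definition common_denominator ::
  "'k::field dyn_model \<Rightarrow> (nat, 'k poly fract) mpoly \<Rightarrow> bool" where
  "common_denominator M Q \<longleftrightarrow>
     Q \<in> state_polys (dim M) \<and> Q \<noteq> 0 \<and>
     (\<forall>i\<in>{1..dim M}. \<exists>a\<in>state_polys (dim M). rhs M i = Fract a Q) \<and>
     (\<exists>b\<in>state_polys (dim M). outp M = Fract b Q)"

datatype indeterminate = U nat | W

definition model_ring :: "nat \<Rightarrow> (indeterminate, 'c::zero) dpoly set" where
  "model_ring N = {P. fst ` indets P \<subseteq> insert W (U ` {1..N})}"

definition lift_state :: "(nat, 'c::comm_ring_1) mpoly \<Rightarrow> (indeterminate, 'c) dpoly" where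
  "lift_state = eval_mpoly Const (\<lambda>i. Var (U i, 0))"

text \<open>For a given nonzero \<open>Q\<close> the numerators $a_i$ and $b$ are unique.\<close>

definition model_gens ::
  "'k::field dyn_model \<Rightarrow> (nat, 'k poly fract) mpoly \<Rightarrow> (indeterminate, 'k poly fract) dpoly set" where
  "model_gens M Q =
     {lift_state Q * Var (U i, 1) - lift_state a | i a. i \<in> {1..dim M} \<and> rhs M i = Fract a Q} \<union>
     {lift_state Q * Var (W, 0) - lift_state b | b. outp M = Fract b Q}"

definition model_ideal ::
  "'k::field dyn_model \<Rightarrow> (nat, 'k poly fract) mpoly \<Rightarrow> (indeterminate, 'k poly fract) dpoly set" where
  "model_ideal M Q =
     saturation (model_ring (dim M))
       (diff_ideal_gen (model_ring (dim M)) (model_gens M Q)) (lift_state Q)"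

text \<open>The elements of $I_M \cap K(x)[w^{(\infty)}]$.\<close>

definition derived_polys ::
  "'k::field dyn_model \<Rightarrow> (nat, 'k poly fract) mpoly \<Rightarrow> (indeterminate, 'k poly fract) dpoly set" where
  "derived_polys M Q = {P \<in> model_ideal M Q. fst ` indets P \<subseteq> {W}}"

text \<open>The value is \<open>\<infinity>\<close> if there is no nonzero derived polynomial that has an order.\<close>

definition min_order :: "'k::field dyn_model \<Rightarrow> (nat, 'k poly fract) mpoly \<Rightarrow> enat" where
  "min_order M Q = Inf {enat k | k P. P \<in> derived_polys M Q \<and> P \<noteq> 0 \<and> has_order P k}"


definition rat_const :: "'k::field poly fract \<Rightarrow> 'k ratfun" where
  "rat_const c = Fract (Const c) 1"

definition rat_var :: "nat \<Rightarrow> 'k::field ratfun" where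
  "rat_var i = Fract (Var i) 1"

text \<open>The rational function $r$ obtained by solving $p = 0$ for $y^{(n)}$, where $p$ has order \<open>n\<close>
  and $y^{(j)}$ is named $u_{s+j+1}$ for $j < n$.  It is unique if \<open>lho p n\<close>.\<close>

definition solved_rhs :: "nat \<Rightarrow> (unit, 'k::field poly fract) dpoly \<Rightarrow> nat \<Rightarrow> 'k ratfun" where
  "solved_rhs s p n =
     (THE r. eval_mpoly rat_const (\<lambda>v. if snd v < n then rat_var (s + snd v + 1) else r) p = 0)"

datatype arith_op = Add | Sub | Mul | Div

fun apply_op :: "arith_op \<Rightarrow> 'r \<Rightarrow> 'r \<Rightarrow> 'r::field" where
  "apply_op Add a b = a + b"
| "apply_op Sub a b = a - b"
| "apply_op Mul a b = a * b"
| "apply_op Div a b = a / b"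

text \<open>The model $M_{\alpha(p,q)}$ for \<open>p\<close> of order \<open>n\<close> and \<open>q\<close> of order \<open>m\<close>.\<close>

definition op_model ::
  "arith_op \<Rightarrow> (unit, 'k::field poly fract) dpoly \<Rightarrow> nat \<Rightarrow> (unit, 'k poly fract) dpoly \<Rightarrow> nat
     \<Rightarrow> 'k dyn_model" where
  "op_model \<alpha> p n q m =
     \<lparr> dim = n + m,
       rhs = (\<lambda>i. if i = n then solved_rhs 0 p n
                  else if i = n + m then solved_rhs n q m
                  else rat_var (i + 1)),
       outp = apply_op \<alpha>
                (if n = 0 then solved_rhs 0 p 0 else rat_var 1)
                (if m = 0 then solved_rhs n q 0 else rat_var (n + 1)) \<rparr>"

end

theory Submission
  imports Defs "HOL-Library.FuncSet"
begin

text \<open>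
  Let \<open>N = n + m\<close> be the number of state variables.  Modulo the differential ideal
  of the model, every derivative $w^{(j)}$ becomes, after multiplication by a power of the
  denominator, a polynomial in $u_1, \ldots, u_N$ alone: the polynomials with this property form a
  subring that contains the $u_i$, the $u_i'$ and $w$, and therefore is closed under derivation.  So
  $w, w', \ldots, w^{(N)}$ are represented by \<open>N + 1\<close> fractions in \<open>N\<close> variables.  These are
  algebraically dependent, since \<open>(D + 1) ^ (N + 1)\<close> monomials in the fractions have numerators in a
  space of dimension \<open>O(D ^ N)\<close>.  Saturation turns the dependency into a derived polynomial.
\<close>

subsection \<open>Polynomials as finitely supported maps\<close>

lemma poly_mapping_sum_single:
  "P = (\<Sum>m\<in>Poly_Mapping.keys P. Poly_Mapping.single m (Poly_Mapping.lookup P m))"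
  by (rule poly_mapping_eqI)
    (simp add: lookup_sum lookup_single when_def sum.delta' in_keys_iff)

text \<open>Every finitely supported map is a finite sum of single terms; the zero map is covered by
  a term with coefficient 0. Biadditive identities thereby reduce to pairs of terms.\<close>

lemma poly_mapping_add_induct [case_names single add]:
  assumes single: "\<And>m c. f (Poly_Mapping.single m c)"
    and add: "\<And>P Q. f P \<Longrightarrow> f Q \<Longrightarrow> f (P + Q)"
  shows "f (P :: 'a \<Rightarrow>\<^sub>0 'b::comm_monoid_add)"
proof -
  have "f (\<Sum>m\<in>A. Poly_Mapping.single m (Poly_Mapping.lookup P m))" if "finite A" for A
    using that
  proof induction
    case empty
    show ?case using single[of undefined 0] by simp
  next
    case (insert x F)
    then show ?case by (simp add: single add)
  qed
  then show ?thesis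
    by (metis finite_keys poly_mapping_sum_single)
qed

lemma Const_add: "Const (a + b) = Const a + Const b"
  by (simp add: Const_def single_add)

lemma Const_mult: "Const (a * b) = Const a * Const b"
  by (simp add: Const_def mult_single)

lemma Const_0: "Const 0 = 0"
  by (simp add: Const_def)

lemma Const_1: "Const 1 = 1"
  by (simp add: Const_def)

lemma lookup_Const_mult:
  "Poly_Mapping.lookup (Const c * P) m = c * Poly_Mapping.lookup P m"
proof (induction P rule: poly_mapping_add_induct)
  case (single m c)
  then show ?case by (simp add: Const_def mult_single lookup_single when_def)
next
  case (add P Q)
  then show ?case by (simp add: distrib_left lookup_add)
qed

lemma Var_power: "Var v ^ k = Poly_Mapping.single (Poly_Mapping.single v k) (1 :: 'c::comm_ring_1)"
  by (induction k) (simp_all add: Var_def mult_single single_add[symmetric])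

lemma prod_single:
  "(\<Prod>i\<in>A. Poly_Mapping.single (f i) (1 :: 'c::comm_ring_1)) = Poly_Mapping.single (\<Sum>i\<in>A. f i) 1"
  by (induction A rule: infinite_finite_induct) (simp_all add: mult_single)

lemma indets_single: "indets (Poly_Mapping.single m c) \<subseteq> Poly_Mapping.keys m"
  by (auto simp: indets_def)

lemma indets_add: "indets (P + Q) \<subseteq> indets P \<union> indets Q"
  using keys_add[of P Q] by (fastforce simp: indets_def)

lemma indets_uminus: "indets (- P :: ('v, 'c::ab_group_add) mpoly) = indets P"
  by (auto simp: indets_def in_keys_iff)

lemma indets_mult: "indets (P * Q :: ('v, 'c::comm_ring_1) mpoly) \<subseteq> indets P \<union> indets Q"
proof -
  have "v \<in> indets P \<union> indets Q" if m: "m \<in> Poly_Mapping.keys (P * Q)" "v \<in> Poly_Mapping.keys m" for v m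
  proof -
    obtain a b where ab: "m = a + b" "a \<in> Poly_Mapping.keys P" "b \<in> Poly_Mapping.keys Q"
      using m(1) keys_mult[of P Q] by blast
    with m(2) keys_add[of a b] show ?thesis
      by (auto simp: indets_def)
  qed
  then show ?thesis
    by (auto simp: indets_def[of "P * Q"])
qed

lemma indets_Const: "indets (Const c) = {}"
  by (auto simp: indets_def Const_def)

lemma indets_Var: "indets (Var v :: ('v, 'c::comm_ring_1) mpoly) = {v}"
  by (auto simp: indets_def Var_def)

lemma indets_sum: "indets (sum f A) \<subseteq> (\<Union>x\<in>A. indets (f x))"
proof (induction A rule: infinite_finite_induct)
  case (insert x F)
  then show ?case using indets_add[of "f x" "sum f F"] by auto
qed (simp_all add: indets_def)


section \<open>Ring homomorphisms as plain functions, and evaluation of polynomials along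
  them\<close>

locale ring_hom_fun =
  fixes h :: "'c::comm_ring_1 \<Rightarrow> 'r::comm_ring_1"
  assumes hom_add: "h (a + b) = h a + h b"
    and hom_mult: "h (a * b) = h a * h b"
    and hom_1: "h 1 = 1"
begin

lemma hom_0: "h 0 = 0"
  using hom_add[of 0 0] by simp

lemma hom_uminus: "h (- a) = - h a"
  by (metis add.right_inverse hom_0 hom_add minus_unique)

lemma eval_mpoly_single:
  "eval_mpoly h f (Poly_Mapping.single m c) =
     h c * (\<Prod>v\<in>Poly_Mapping.keys m. f v ^ Poly_Mapping.lookup m v)"
  by (simp add: eval_mpoly_def hom_0)

lemma eval_mpoly_add: "eval_mpoly h f (P + Q) = eval_mpoly h f P + eval_mpoly h f Q"
  unfolding eval_mpoly_def
  by (rule setsum_keys_plus_distrib) (simp_all add: hom_0 hom_add distrib_right)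

lemma prod_powers_add:
  fixes f :: "'v \<Rightarrow> 'r"
  shows "(\<Prod>v\<in>Poly_Mapping.keys (m + m'). f v ^ Poly_Mapping.lookup (m + m') v) =
    (\<Prod>v\<in>Poly_Mapping.keys m. f v ^ Poly_Mapping.lookup m v) *
    (\<Prod>v\<in>Poly_Mapping.keys m'. f v ^ Poly_Mapping.lookup m' v)"
proof -
  let ?A = "Poly_Mapping.keys m \<union> Poly_Mapping.keys m'"
  \<comment> \<open>All three products are taken over the same support; the added factors have
    exponent 0 and equal 1.\<close>
  have "(\<Prod>v\<in>Poly_Mapping.keys k. f v ^ Poly_Mapping.lookup k v) =
      (\<Prod>v\<in>?A. f v ^ Poly_Mapping.lookup k v)" if "Poly_Mapping.keys k \<subseteq> ?A" for k
    using that by (intro prod.mono_neutral_left) (auto simp: in_keys_iff)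
  from this[of m] this[of m'] this[of "m + m'"] keys_add[of m m'] show ?thesis
    by (simp add: lookup_add power_add prod.distrib)
qed

lemma eval_mpoly_mult: "eval_mpoly h f (P * Q) = eval_mpoly h f P * eval_mpoly h f Q"
proof (induction P rule: poly_mapping_add_induct)
  case (single m c)
  show ?case
  proof (induction Q rule: poly_mapping_add_induct)
    case (single m' c')
    then show ?case
      by (simp add: mult_single eval_mpoly_single hom_mult prod_powers_add mult_ac)
  next
    case (add P Q)
    then show ?case by (simp add: distrib_left eval_mpoly_add)
  qed
next
  case (add P Q)
  then show ?case by (simp add: distrib_right eval_mpoly_add)
qed

lemma eval_mpoly_Const: "eval_mpoly h f (Const c) = h c"
  by (simp add: Const_def eval_mpoly_single)

lemma eval_mpoly_Var: "eval_mpoly h f (Var v) = f v"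
  by (simp add: Var_def eval_mpoly_single hom_1)

lemma eval_mpoly_ring_hom: "ring_hom_fun (eval_mpoly h f)"
  by unfold_locales
    (simp_all add: eval_mpoly_add eval_mpoly_mult eval_mpoly_Const[of f 1, unfolded Const_1] hom_1)

lemma hom_power: "h (a ^ k) = h a ^ k"
  by (induction k) (simp_all add: hom_1 hom_mult)

lemma hom_prod: "h (prod g A) = (\<Prod>x\<in>A. h (g x))"
  by (induction A rule: infinite_finite_induct) (simp_all add: hom_1 hom_mult)

lemma hom_sum: "h (sum g A) = (\<Sum>x\<in>A. h (g x))"
  by (induction A rule: infinite_finite_induct) (simp_all add: hom_0 hom_add)

end

interpretation Const_hom: ring_hom_fun "Const :: 'c::comm_ring_1 \<Rightarrow> ('v, 'c) mpoly"
  by unfold_locales (simp_all add: Const_add Const_mult Const_1)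

interpretation lift_hom: ring_hom_fun "lift_state :: (nat, 'c::comm_ring_1) mpoly \<Rightarrow> _"
  unfolding lift_state_def by (rule Const_hom.eval_mpoly_ring_hom)

lemma lift_state_Const: "lift_state (Const c) = Const c"
  by (simp add: lift_state_def Const_hom.eval_mpoly_Const)

lemma lift_state_Var: "lift_state (Var i) = Var (U i, 0)"
  by (simp add: lift_state_def Const_hom.eval_mpoly_Var)


subsection \<open>The derivation\<close>

lemma fract_deriv_add: "fract_deriv (a + b) = fract_deriv a + fract_deriv b"
proof (induction a; induction b)
  fix a b c d :: "'a poly"
  assume "b \<noteq> 0" "d \<noteq> 0"
  then show "fract_deriv (Fract a b + Fract c d) = fract_deriv (Fract a b) + fract_deriv (Fract c d)"
    by (simp add: fract_deriv_Fract eq_fract pderiv_mult pderiv_add algebra_simps)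
qed

lemma fract_deriv_mult: "fract_deriv (a * b) = fract_deriv a * b + a * fract_deriv b"
proof (induction a; induction b)
  fix a b c d :: "'a poly"
  assume "b \<noteq> 0" "d \<noteq> 0"
  then show "fract_deriv (Fract a b * Fract c d) =
      fract_deriv (Fract a b) * Fract c d + Fract a b * fract_deriv (Fract c d)"
    by (simp add: fract_deriv_Fract eq_fract pderiv_mult pderiv_add algebra_simps)
qed

lemma fract_deriv_0: "fract_deriv 0 = 0"
  using fract_deriv_add[of 0 0] by (metis add.right_neutral add_left_cancel)

lemma fract_deriv_1: "fract_deriv 1 = 0"
  using fract_deriv_mult[of 1 1] by (metis add.right_neutral add_left_cancel mult_1 mult_1_right)

text \<open>The derivative of a monic monomial. Isolating it from \<open>ddiff\<close> separates the
  Leibniz rule for monomials from the one for coefficients.\<close>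

definition mono_diff :: "('i \<times> nat \<Rightarrow>\<^sub>0 nat) \<Rightarrow> ('i, 'c::comm_ring_1) dpoly" where
  "mono_diff m = (\<Sum>v\<in>Poly_Mapping.keys m.
     Poly_Mapping.single (m - Poly_Mapping.single v 1 + Poly_Mapping.single (fst v, Suc (snd v)) 1)
       (of_nat (Poly_Mapping.lookup m v)))"

lemma mono_diff_superset:
  assumes "finite A" "Poly_Mapping.keys m \<subseteq> A"
  shows "mono_diff m = (\<Sum>v\<in>A.
     Poly_Mapping.single (m - Poly_Mapping.single v 1 + Poly_Mapping.single (fst v, Suc (snd v)) 1)
       (of_nat (Poly_Mapping.lookup m v)))"
  unfolding mono_diff_def
  using assms by (intro sum.mono_neutral_left) (auto simp: in_keys_iff)

text \<open>The difference \<open>m - single v 1\<close> truncates when \<open>v\<close> does not occur in \<open>m\<close>, but then the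
  coefficient vanishes.\<close>

lemma mono_diff_add:
  "mono_diff (m + m') =
     Poly_Mapping.single m (1 :: 'c::comm_ring_1) * mono_diff m' + mono_diff m * Poly_Mapping.single m' 1"
proof -
  let ?A = "Poly_Mapping.keys m \<union> Poly_Mapping.keys m'"
  let ?s = "\<lambda>v. Poly_Mapping.single v (1 :: nat)"
  let ?t = "\<lambda>k m v. Poly_Mapping.single (k - ?s v + ?s (fst v, Suc (snd v)))
    (of_nat (Poly_Mapping.lookup m v) :: 'c)"
  have *: "?t (k + l) k v = ?t k k v * Poly_Mapping.single l 1" for k l :: "'a \<times> nat \<Rightarrow>\<^sub>0 nat" and v
  proof (cases "Poly_Mapping.lookup k v = 0")
    case False
    then have "k + l - ?s v = k - ?s v + l"
      by (intro poly_mapping_eqI) (auto simp: lookup_add lookup_minus lookup_single when_def)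
    then show ?thesis by (simp add: mult_single add_ac)
  qed simp
  have "mono_diff (m + m') = (\<Sum>v\<in>?A. ?t (m + m') (m + m') v)"
    by (rule mono_diff_superset) (use keys_add[of m m'] in auto)
  also have "\<dots> = (\<Sum>v\<in>?A. ?t (m' + m) m' v + ?t (m + m') m v)"
    by (simp add: lookup_add single_add add.commute)
  also have "\<dots> = (\<Sum>v\<in>?A. ?t m' m' v) * Poly_Mapping.single m 1 +
      (\<Sum>v\<in>?A. ?t m m v) * Poly_Mapping.single m' 1"
    unfolding * by (simp add: sum.distrib sum_distrib_right)
  also have "\<dots> = mono_diff m' * Poly_Mapping.single m 1 + mono_diff m * Poly_Mapping.single m' 1"
    by (simp add: mono_diff_superset[of ?A])
  finally show ?thesis by (simp add: mult.commute)
qed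

lemma ddiff_alt:
  "ddiff P = (\<Sum>m\<in>Poly_Mapping.keys P.
     Poly_Mapping.single m (fract_deriv (Poly_Mapping.lookup P m)) +
     Const (Poly_Mapping.lookup P m) * mono_diff m)"
  unfolding ddiff_def mono_diff_def
  by (simp add: sum_distrib_left Const_def mult_single mult.commute)

lemma ddiff_single:
  "ddiff (Poly_Mapping.single m c) = Poly_Mapping.single m (fract_deriv c) + Const c * mono_diff m"
  by (simp add: ddiff_alt fract_deriv_0 Const_0)

lemma ddiff_add: "ddiff (P + Q) = ddiff P + ddiff Q"
  unfolding ddiff_alt
  by (rule setsum_keys_plus_distrib)
    (simp_all add: fract_deriv_0 Const_0 fract_deriv_add Const_add single_add distrib_right)

lemma ddiff_mult: "ddiff (P * Q) = ddiff P * Q + P * ddiff Q"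
proof (induction P rule: poly_mapping_add_induct)
  case (single m c)
  show ?case
  proof (induction Q rule: poly_mapping_add_induct)
    case (single m' c')
    \<comment> \<open>Each term is split into a constant and a monic monomial, so that the Leibniz
      rules for coefficients and for monomials combine by ring arithmetic alone.\<close>
    have *: "Poly_Mapping.single k a = Const a * Poly_Mapping.single k 1" for k and a :: "'b poly fract"
      by (simp add: Const_def mult_single)
    have **: "Poly_Mapping.single (m + m') a = Const a * (Poly_Mapping.single m 1 * Poly_Mapping.single m' 1)"
      for a :: "'b poly fract"
      by (simp add: Const_def mult_single)
    show ?case
      unfolding ddiff_single mult_single mono_diff_add fract_deriv_mult
      unfolding ** *[of m c] *[of m' c'] *[of m "fract_deriv c"] *[of m' "fract_deriv c'"]
      by (simp only: Const_add Const_mult) (simp only: algebra_simps)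
  next
    case (add P Q)
    then show ?case by (simp add: distrib_left ddiff_add)
  qed
next
  case (add P Q)
  then show ?case by (simp add: distrib_right ddiff_add)
qed

lemma ddiff_0: "ddiff 0 = 0"
  by (simp add: ddiff_alt)

lemma ddiff_Const: "ddiff (Const c) = Const (fract_deriv c)"
  unfolding Const_def ddiff_single by (simp add: mono_diff_def)

lemma ddiff_1: "ddiff 1 = 0"
  using ddiff_Const[of 1] by (simp add: fract_deriv_1 Const_0 Const_1)

lemma ddiff_Var: "ddiff (Var (i, j)) = Var (i, Suc j)"
  unfolding Var_def ddiff_single by (simp add: mono_diff_def fract_deriv_1 Const_1 mult_single)

lemma ddiff_uminus: "ddiff (- P) = - ddiff P"
  by (metis add.right_inverse ddiff_0 ddiff_add minus_unique)

lemma ddiff_diff: "ddiff (P - Q) = ddiff P - ddiff Q"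
  using ddiff_add[of P "- Q"] by (simp add: ddiff_uminus)

lemma ddiff_sum: "ddiff (sum f A) = (\<Sum>x\<in>A. ddiff (f x))"
  by (induction A rule: infinite_finite_induct) (simp_all add: ddiff_0 ddiff_add)


subsection \<open>Subrings and ideals\<close>

locale subring_set =
  fixes R :: "'r::comm_ring_1 set"
  assumes one_mem: "1 \<in> R"
    and add_mem: "a \<in> R \<Longrightarrow> b \<in> R \<Longrightarrow> a + b \<in> R"
    and mult_mem: "a \<in> R \<Longrightarrow> b \<in> R \<Longrightarrow> a * b \<in> R"
    and uminus_mem: "a \<in> R \<Longrightarrow> - a \<in> R"
begin

lemma diff_mem: "a \<in> R \<Longrightarrow> b \<in> R \<Longrightarrow> a - b \<in> R"
  using add_mem[of a "- b"] uminus_mem[of b] by simp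

lemma zero_mem: "0 \<in> R"
  using diff_mem[OF one_mem one_mem] by simp

lemma power_mem: "a \<in> R \<Longrightarrow> a ^ k \<in> R"
  by (induction k) (simp_all add: one_mem mult_mem)

lemma sum_mem: "(\<And>x. x \<in> A \<Longrightarrow> f x \<in> R) \<Longrightarrow> sum f A \<in> R"
  by (induction A rule: infinite_finite_induct) (simp_all add: zero_mem add_mem)

lemma prod_mem: "(\<And>x. x \<in> A \<Longrightarrow> f x \<in> R) \<Longrightarrow> prod f A \<in> R"
  by (induction A rule: infinite_finite_induct) (simp_all add: one_mem mult_mem)

text \<open>A subring containing the images of the constants and of the occurring variables contains
  every value. This turns membership proofs for polynomials into checks on generators.\<close>

lemma eval_mpoly_mem:
  assumes "\<And>c. h c \<in> R" "\<And>v. v \<in> indets P \<Longrightarrow> f v \<in> R"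
  shows "eval_mpoly h f P \<in> R"
  unfolding eval_mpoly_def
  using assms by (intro sum_mem mult_mem prod_mem power_mem) (auto simp: indets_def)

lemma ideal_gen_add:
  assumes "x \<in> ideal_gen R S" "y \<in> ideal_gen R S"
  shows "x + y \<in> ideal_gen R S"
proof -
  obtain A c where x: "x = (\<Sum>s\<in>A. c s * s)" "finite A" "A \<subseteq> S" "c ` A \<subseteq> R"
    using assms(1) by (auto simp: ideal_gen_def)
  obtain B d where y: "y = (\<Sum>s\<in>B. d s * s)" "finite B" "B \<subseteq> S" "d ` B \<subseteq> R"
    using assms(2) by (auto simp: ideal_gen_def)
  \<comment> \<open>The two combinations may use different finite sets of generators, so both are
    extended by zero coefficients to the union.\<close>
  let ?c = "\<lambda>s. if s \<in> A then c s else 0"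
  let ?d = "\<lambda>s. if s \<in> B then d s else 0"
  have "x = (\<Sum>s\<in>A \<union> B. ?c s * s)"
    unfolding x(1) by (intro sum.mono_neutral_cong_left) (use x y in auto)
  moreover have "y = (\<Sum>s\<in>A \<union> B. ?d s * s)"
    unfolding y(1) by (intro sum.mono_neutral_cong_left) (use x y in auto)
  ultimately have "x + y = (\<Sum>s\<in>A \<union> B. (?c s + ?d s) * s)"
    by (simp only: distrib_right sum.distrib)
  moreover have "(\<lambda>s. ?c s + ?d s) ` (A \<union> B) \<subseteq> R"
    using x(4) y(4) by (intro image_subsetI add_mem) (auto simp: zero_mem)
  ultimately show ?thesis
    using x y unfolding ideal_gen_def
    by (intro CollectI exI[of _ "A \<union> B"] exI[of _ "\<lambda>s. ?c s + ?d s"]) auto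
qed

lemma ideal_gen_mult:
  assumes "a \<in> R" "x \<in> ideal_gen R S"
  shows "a * x \<in> ideal_gen R S"
proof -
  obtain A c where x: "x = (\<Sum>s\<in>A. c s * s)" "finite A" "A \<subseteq> S" "c ` A \<subseteq> R"
    using assms(2) by (auto simp: ideal_gen_def)
  have "a * x = (\<Sum>s\<in>A. (a * c s) * s)"
    by (simp add: x(1) sum_distrib_left mult.assoc)
  then show ?thesis
    using x assms(1) unfolding ideal_gen_def
    by (intro CollectI exI[of _ A] exI[of _ "\<lambda>s. a * c s"]) (auto intro: mult_mem)
qed

lemma ideal_gen_zero: "0 \<in> ideal_gen R S"
  unfolding ideal_gen_def by (intro CollectI exI[of _ "{}"]) auto

lemma ideal_gen_sum: "(\<And>i. i \<in> A \<Longrightarrow> f i \<in> ideal_gen R S) \<Longrightarrow> sum f A \<in> ideal_gen R S"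
  by (induction A rule: infinite_finite_induct) (simp_all add: ideal_gen_zero ideal_gen_add)

lemma ideal_gen_generator: "s \<in> S \<Longrightarrow> s \<in> ideal_gen R S"
  unfolding ideal_gen_def
  by (intro CollectI exI[of _ "{s}"] exI[of _ "\<lambda>_. 1"]) (auto intro: one_mem)

end

section \<open>The polynomial rings and the differential ideal of a model\<close>

lemma subring_indets: "subring_set {P :: ('v, 'c::comm_ring_1) mpoly. indets P \<subseteq> V}"
proof
  fix P Q :: "('v, 'c) mpoly"
  assume P: "P \<in> {P. indets P \<subseteq> V}"
  then show "- P \<in> {P. indets P \<subseteq> V}" by (simp add: indets_uminus)
  assume Q: "Q \<in> {P. indets P \<subseteq> V}"
  show "P + Q \<in> {P. indets P \<subseteq> V}" using P Q indets_add[of P Q] by auto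
  show "P * Q \<in> {P. indets P \<subseteq> V}" using P Q indets_mult[of P Q] by auto
qed (simp add: indets_def)

interpretation state: subring_set "state_polys N :: (nat, 'c::comm_ring_1) mpoly set" for N
  unfolding state_polys_def by (rule subring_indets)

lemma model_ring_alt: "model_ring N = {P. indets P \<subseteq> (insert W (U ` {1..N})) \<times> UNIV}"
  by (force simp: model_ring_def)

interpretation model: subring_set "model_ring N :: (indeterminate, 'c::comm_ring_1) dpoly set" for N
  unfolding model_ring_alt by (rule subring_indets)

lemma Const_in_model_ring: "Const c \<in> model_ring N"
  by (simp add: model_ring_def indets_Const)

lemma U_in_model_ring: "i \<in> {1..N} \<Longrightarrow> Var (U i, j) \<in> model_ring N"
  by (simp add: model_ring_def indets_Var)

lemma W_in_model_ring: "Var (W, j) \<in> model_ring N"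
  by (simp add: model_ring_def indets_Var)

lemma lift_state_in_model_ring: "P \<in> state_polys N \<Longrightarrow> lift_state P \<in> model_ring N"
  unfolding lift_state_def
  by (rule model.eval_mpoly_mem) (auto simp: state_polys_def intro!: Const_in_model_ring U_in_model_ring)

lemma ddiff_in_model_ring:
  assumes P: "P \<in> model_ring N"
  shows "ddiff P \<in> model_ring N"
proof -
  have single: "Poly_Mapping.single k c \<in> model_ring N"
    if "fst ` Poly_Mapping.keys k \<subseteq> insert W (U ` {1..N})"
    for k and c :: "'a poly fract"
    using that indets_single[of k c] unfolding model_ring_def by blast
  have keys: "fst ` Poly_Mapping.keys m \<subseteq> insert W (U ` {1..N})" if "m \<in> Poly_Mapping.keys P" for m
    using P that unfolding model_ring_def indets_def by blast
  \<comment> \<open>The only variable that can be new is the derivative of \<open>v\<close>, which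
    belongs to the same differential indeterminate.\<close>
  have "Poly_Mapping.keys (m - Poly_Mapping.single v 1 + Poly_Mapping.single (fst v, Suc (snd v)) 1)
      \<subseteq> insert (fst v, Suc (snd v)) (Poly_Mapping.keys m)"
    for m :: "indeterminate \<times> nat \<Rightarrow>\<^sub>0 nat" and v
    by (auto simp: in_keys_iff lookup_add lookup_minus lookup_single when_def split: if_splits)
  then have "fst ` Poly_Mapping.keys
      (m - Poly_Mapping.single v 1 + Poly_Mapping.single (fst v, Suc (snd v)) 1)
      \<subseteq> fst ` Poly_Mapping.keys m"
    if "v \<in> Poly_Mapping.keys m" for m :: "indeterminate \<times> nat \<Rightarrow>\<^sub>0 nat" and v
    using that by (fastforce dest: subsetD)
  then show ?thesis
    unfolding ddiff_def using keys
    by (intro model.sum_mem model.add_mem single) (blast dest: subset_trans)+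
qed

text \<open>The generating set is closed under derivation, and by the Leibniz rule each summand
  \<open>c s * s\<close> has its derivative in the ideal spanned by \<open>s\<close> and
  \<open>ddiff s\<close>.\<close>

lemma ddiff_in_diff_ideal_gen:
  assumes "x \<in> diff_ideal_gen (model_ring N) S"
  shows "ddiff x \<in> diff_ideal_gen (model_ring N) S"
proof -
  let ?S = "{(ddiff ^^ k) s | k s. s \<in> S}"
  let ?J = "ideal_gen (model_ring N) ?S"
  obtain A c where x: "x = (\<Sum>s\<in>A. c s * s)" "finite A" "A \<subseteq> ?S" "c ` A \<subseteq> model_ring N"
    using assms by (auto simp: diff_ideal_gen_def ideal_gen_def)
  have "ddiff (c s * s) \<in> ?J" if s: "s \<in> A" for s
  proof -
    obtain k t where kt: "s = (ddiff ^^ k) t" "t \<in> S" using s x(3) by auto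
    then have "ddiff s = (ddiff ^^ Suc k) t" by simp
    then have "ddiff s \<in> ?J" "s \<in> ?J"
      using kt by (blast intro: model.ideal_gen_generator)+
    then show ?thesis
      unfolding ddiff_mult using s x(4)
      by (intro model.ideal_gen_add model.ideal_gen_mult ddiff_in_model_ring) auto
  qed
  then show ?thesis
    unfolding diff_ideal_gen_def x(1) ddiff_sum by (rule model.ideal_gen_sum)
qed


subsection \<open>Elimination of derivatives\<close>

locale model_with_denominator =
  fixes M :: "'k::field dyn_model" and Q :: "(nat, 'k poly fract) mpoly"
  assumes common_denominator: "common_denominator M Q"
begin

abbreviation "ring \<equiv> model_ring (dim M) :: (indeterminate, 'k poly fract) dpoly set"
abbreviation "J \<equiv> diff_ideal_gen ring (model_gens M Q)"
abbreviation "q \<equiv> lift_state Q"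

lemma J_add: "x \<in> J \<Longrightarrow> y \<in> J \<Longrightarrow> x + y \<in> J"
  unfolding diff_ideal_gen_def by (rule model.ideal_gen_add)

lemma J_mult: "a \<in> ring \<Longrightarrow> x \<in> J \<Longrightarrow> a * x \<in> J"
  unfolding diff_ideal_gen_def by (rule model.ideal_gen_mult)

lemma J_zero: "0 \<in> J"
  unfolding diff_ideal_gen_def by (rule model.ideal_gen_zero)

lemma Q_state: "Q \<in> state_polys (dim M)"
  using common_denominator by (simp add: common_denominator_def)

lemma q_in_ring: "q \<in> ring"
  by (rule lift_state_in_model_ring[OF Q_state])

text \<open>Modulo \<open>J\<close> and after inverting \<open>q\<close>, such a \<open>P\<close>
  equals the fraction \<open>R / Q ^ k\<close> in the state variables alone.\<close>

definition reducible :: "(indeterminate, 'k poly fract) dpoly set" where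
  "reducible = {P \<in> ring. \<exists>k. \<exists>R\<in>state_polys (dim M). q ^ k * P - lift_state R \<in> J}"

text \<open>Expanding the fraction \<open>R / Q ^ k\<close> to the denominator \<open>Q ^ l\<close>;
  needed to bring several reductions to a common denominator.\<close>

lemma reducible_mono:
  assumes "q ^ k * P - lift_state R \<in> J" "k \<le> l"
  shows "q ^ l * P - lift_state (Q ^ (l - k) * R) \<in> J"
proof -
  have "q ^ l = q ^ (l - k) * q ^ k"
    using assms(2) by (simp flip: power_add)
  then have "q ^ l * P - lift_state (Q ^ (l - k) * R) = q ^ (l - k) * (q ^ k * P - lift_state R)"
    by (simp add: lift_hom.hom_mult lift_hom.hom_power right_diff_distrib mult.assoc)
  then show ?thesis
    using assms(1) by (simp add: J_mult model.power_mem q_in_ring)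
qed

lemma congruent_mult:
  assumes "a - a' \<in> J" "b - b' \<in> J" "a \<in> ring" "b' \<in> ring"
  shows "a * b - a' * b' \<in> J"
proof -
  \<comment> \<open>\<open>J\<close> absorbs only factors from \<open>ring\<close>; in this
    splitting they are \<open>a\<close> and \<open>b'\<close>.\<close>
  have "a * b - a' * b' = a * (b - b') + b' * (a - a')" by (simp add: algebra_simps)
  then show ?thesis using assms by (simp only: J_add J_mult)
qed

lemma lift_reducible:
  assumes "R \<in> state_polys (dim M)" shows "lift_state R \<in> reducible"
  unfolding reducible_def using assms
  by (intro CollectI conjI lift_state_in_model_ring exI[of _ 0] bexI[of _ R]) (simp_all add: J_zero)

text \<open>The arithmetic of fractions whose denominators are powers of \<open>Q\<close>: sums are
  formed over the common denominator \<open>Q ^ (k + l)\<close>, and products add the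
  exponents.\<close>

interpretation red: subring_set reducible
proof
  show "1 \<in> reducible"
    using lift_reducible[OF state.one_mem] by (simp add: lift_hom.hom_1)
  fix a b assume "a \<in> reducible"
  then obtain k R where a: "a \<in> ring" "R \<in> state_polys (dim M)" "q ^ k * a - lift_state R \<in> J"
    unfolding reducible_def by blast
  show "- a \<in> reducible"
  proof -
    have "q ^ k * (- a) - lift_state (- R) = (- 1) * (q ^ k * a - lift_state R)"
      by (simp add: lift_hom.hom_uminus)
    also have "\<dots> \<in> J" using a(3) by (intro J_mult model.uminus_mem model.one_mem)
    finally show ?thesis
      unfolding reducible_def using a by (blast intro: model.uminus_mem state.uminus_mem)
  qed
  assume "b \<in> reducible"
  then obtain l S where b: "b \<in> ring" "S \<in> state_polys (dim M)" "q ^ l * b - lift_state S \<in> J"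
    unfolding reducible_def by blast
  show "a + b \<in> reducible"
  proof -
    let ?k = "k + l"
    let ?R = "Q ^ (?k - k) * R" and ?S = "Q ^ (?k - l) * S"
    have "q ^ ?k * a - lift_state ?R \<in> J" "q ^ ?k * b - lift_state ?S \<in> J"
      by (rule reducible_mono[OF a(3)], simp) (rule reducible_mono[OF b(3)], simp)
    then have "(q ^ ?k * a - lift_state ?R) + (q ^ ?k * b - lift_state ?S) \<in> J"
      by (rule J_add)
    then have "q ^ ?k * (a + b) - lift_state (?R + ?S) \<in> J"
      unfolding lift_hom.hom_add distrib_left add_diff_add .
    moreover have "?R + ?S \<in> state_polys (dim M)"
      using a b Q_state by (intro state.add_mem state.mult_mem state.power_mem)
    ultimately show ?thesis
      unfolding reducible_def using a b by (blast intro: model.add_mem)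
  qed
  show "a * b \<in> reducible"
  proof -
    have "(q ^ k * a) * (q ^ l * b) - lift_state R * lift_state S \<in> J"
      using a b by (intro congruent_mult model.mult_mem model.power_mem q_in_ring lift_state_in_model_ring)
    then have "q ^ (k + l) * (a * b) - lift_state (R * S) \<in> J"
      by (simp add: lift_hom.hom_mult power_add mult_ac)
    then show ?thesis
      unfolding reducible_def using a b by (blast intro: model.mult_mem state.mult_mem)
  qed
qed

text \<open>Division by powers of \<open>q\<close> stays within \<open>reducible\<close>, so an
  equation with leading factor \<open>q ^ k\<close> can be solved for \<open>P\<close>.\<close>

lemma reducible_if_congruent:
  assumes "P \<in> ring" "q ^ k * P - P' \<in> J" "P' \<in> reducible"
  shows "P \<in> reducible"
proof -
  obtain l R where R: "R \<in> state_polys (dim M)" "q ^ l * P' - lift_state R \<in> J"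
    using assms(3) unfolding reducible_def by blast
  have "q ^ (l + k) * P - lift_state R = q ^ l * (q ^ k * P - P') + (q ^ l * P' - lift_state R)"
    by (simp add: algebra_simps power_add)
  also have "\<dots> \<in> J"
    using assms(2) R(2) by (intro J_add J_mult model.power_mem q_in_ring)
  finally show ?thesis
    unfolding reducible_def using assms(1) R(1) by blast
qed

lemma generator_in_J:
  assumes "g \<in> model_gens M Q" shows "g \<in> J"
  unfolding diff_ideal_gen_def
  using assms by (intro model.ideal_gen_generator) (auto intro!: exI[of _ 0] exI[of _ g])

lemma state_derivative_reducible:
  assumes i: "i \<in> {1..dim M}" shows "Var (U i, 1) \<in> reducible"
proof -
  obtain a where a: "a \<in> state_polys (dim M)" "rhs M i = Fract a Q"
    using common_denominator i unfolding common_denominator_def by blast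
  then have "q * Var (U i, 1) - lift_state a \<in> J"
    using i by (intro generator_in_J) (auto simp: model_gens_def)
  then show ?thesis
    using reducible_if_congruent[of "Var (U i, 1)" 1, OF U_in_model_ring[OF i]] lift_reducible[OF a(1)]
    by simp
qed

lemma output_reducible: "Var (W, 0) \<in> reducible"
proof -
  obtain b where b: "b \<in> state_polys (dim M)" "outp M = Fract b Q"
    using common_denominator unfolding common_denominator_def by blast
  then have "q * Var (W, 0) - lift_state b \<in> J"
    by (intro generator_in_J) (auto simp: model_gens_def)
  then show ?thesis
    using reducible_if_congruent[of "Var (W, 0)" 1, OF W_in_model_ring] lift_reducible[OF b(1)]
    by simp
qed

text \<open>By the Leibniz rule, the reducible elements with reducible derivative form a subring. It
  contains the constants and the state variables, whose derivatives are reducible by the model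
  equations, hence all polynomials in the states.\<close>

lemma ddiff_lift_reducible:
  assumes R: "R \<in> state_polys (dim M)" shows "ddiff (lift_state R) \<in> reducible"
proof -
  let ?T = "{P \<in> reducible. ddiff P \<in> reducible}"
  have C: "Const c \<in> reducible" for c
    using lift_reducible[of "Const c"] by (simp add: lift_state_Const state_polys_def indets_Const)
  have V: "Var (U i, 0) \<in> reducible" if "i \<in> {1..dim M}" for i
    using lift_reducible[of "Var i"] that by (simp add: lift_state_Var state_polys_def indets_Var)
  interpret T: subring_set ?T
    by unfold_locales
      (auto simp: red.zero_mem red.one_mem red.add_mem red.mult_mem red.uminus_mem
        ddiff_1 ddiff_add ddiff_mult ddiff_uminus)
  have "lift_state R \<in> ?T"
    unfolding lift_state_def
    by (rule T.eval_mpoly_mem)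
      (use R C V state_derivative_reducible in \<open>auto simp: ddiff_Const ddiff_Var state_polys_def\<close>)
  then show ?thesis by simp
qed

text \<open>Since \<open>J\<close> is closed under derivation, the congruence of
  \<open>q ^ k * P\<close> with a state polynomial may be differentiated and solved for
  \<open>q ^ k * ddiff P\<close>; what remains on the other side is reducible.\<close>

lemma ddiff_reducible:
  assumes P: "P \<in> reducible" shows "ddiff P \<in> reducible"
proof -
  obtain k R where R: "P \<in> ring" "R \<in> state_polys (dim M)" "q ^ k * P - lift_state R \<in> J"
    using P unfolding reducible_def by blast
  have "q ^ k * ddiff P - (ddiff (lift_state R) - ddiff (q ^ k) * P) = ddiff (q ^ k * P - lift_state R)"
    by (simp add: ddiff_mult ddiff_diff)
  also have "\<dots> \<in> J"
    by (rule ddiff_in_diff_ideal_gen[OF R(3)])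
  finally have "q ^ k * ddiff P - (ddiff (lift_state R) - ddiff (q ^ k) * P) \<in> J" .
  moreover have "ddiff (q ^ k) \<in> reducible"
    using ddiff_lift_reducible[OF state.power_mem[OF Q_state], of k] by (simp add: lift_hom.hom_power)
  then have "ddiff (lift_state R) - ddiff (q ^ k) * P \<in> reducible"
    using P R(2) by (intro red.diff_mem red.mult_mem ddiff_lift_reducible)
  ultimately show ?thesis
    using R(1) by (blast intro: reducible_if_congruent ddiff_in_model_ring)
qed

lemma output_derivative_reducible: "Var (W, j) \<in> reducible"
proof (induction j)
  case 0
  show ?case by (rule output_reducible)
next
  case (Suc j)
  then show ?case using ddiff_reducible ddiff_Var by metis
qed

end


subsection \<open>Linear dependence by counting monomials\<close>

text \<open>Gaussian elimination by induction on the equations: one equation with a nonzero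
  coefficient is solved for an unknown \<open>x0\<close>, which is then substituted into the
  others.\<close>

lemma underdetermined_system:
  fixes a :: "'b \<Rightarrow> 'a \<Rightarrow> 'c::field"
  assumes "finite B" "finite A" "card B < card A"
  shows "\<exists>c. (\<exists>x\<in>A. c x \<noteq> 0) \<and> (\<forall>b\<in>B. (\<Sum>x\<in>A. c x * a b x) = 0)"
  using assms
proof (induction B arbitrary: A a rule: finite_induct)
  case empty
  then show ?case by (intro exI[of _ "\<lambda>_. 1"]) (auto simp: card_gt_0_iff)
next
  case (insert b B)
  show ?case
  proof (cases "\<forall>x\<in>A. a b x = 0")
    case True
    with insert.IH[of A a] insert.prems insert.hyps show ?thesis by auto
  next
    case False
    then obtain x0 where x0: "x0 \<in> A" "a b x0 \<noteq> 0" by blast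
    let ?A = "A - {x0}"
    define r where "r x = a b x / a b x0" for x
    have "card B < card ?A" using insert.prems insert.hyps x0 by (simp add: card_Diff_singleton)
    with insert.IH[of ?A "\<lambda>b' x. a b' x - a b' x0 * r x"] insert.prems
    obtain c where c: "\<exists>x\<in>?A. c x \<noteq> 0"
      "\<And>b'. b' \<in> B \<Longrightarrow> (\<Sum>x\<in>?A. c x * (a b' x - a b' x0 * r x)) = 0"
      by auto
    \<comment> \<open>Back substitution: the value at \<open>x0\<close> is dictated by equation
      \<open>b\<close>.\<close>
    define d where "d x = (if x = x0 then - (\<Sum>x\<in>?A. c x * r x) else c x)" for x
    have d: "(\<Sum>x\<in>A. d x * a b' x) = (\<Sum>x\<in>?A. c x * (a b' x - a b' x0 * r x))" for b'
    proof -
      have "(\<Sum>x\<in>A. d x * a b' x) = d x0 * a b' x0 + (\<Sum>x\<in>?A. d x * a b' x)"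
        using insert.prems(1) x0(1) by (simp add: sum.remove)
      also have "(\<Sum>x\<in>?A. d x * a b' x) = (\<Sum>x\<in>?A. c x * a b' x)"
        by (intro sum.cong) (auto simp: d_def)
      finally show ?thesis
        by (simp add: d_def sum_distrib_left sum_distrib_right sum_subtractf algebra_simps)
    qed
    have "(\<Sum>x\<in>A. d x * a b' x) = 0" if "b' \<in> insert b B" for b'
    proof (cases "b' = b")
      case True
      \<comment> \<open>For equation \<open>b\<close> itself every reduced coefficient
        \<open>a b x - a b x0 * r x\<close> vanishes.\<close>
      then show ?thesis using x0(2) by (simp add: d r_def)
    next
      case False
      then show ?thesis using that c(2) by (simp add: d)
    qed
    moreover have "\<exists>x\<in>A. d x \<noteq> 0" using c(1) by (auto simp: d_def)
    ultimately show ?thesis by blast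
  qed
qed

text \<open>The degree is bounded in each variable separately rather than in total: the bounds still
  add under multiplication, and the monomials are easily counted.\<close>

definition box_polys :: "nat \<Rightarrow> nat \<Rightarrow> (nat, 'c::zero) mpoly set" where
  "box_polys N d = {P \<in> state_polys N. \<forall>m\<in>Poly_Mapping.keys P. \<forall>i. Poly_Mapping.lookup m i \<le> d}"

lemma box_polys_mono: "d \<le> e \<Longrightarrow> box_polys N d \<subseteq> box_polys N e"
  unfolding box_polys_def by (auto intro: le_trans)

lemma box_polys_mult:
  fixes P R :: "(nat, 'c::comm_ring_1) mpoly"
  assumes "P \<in> box_polys N d" "R \<in> box_polys N e"
  shows "P * R \<in> box_polys N (d + e)"
  using assms keys_mult[of P R] state.mult_mem[of P N R]
  by (fastforce simp: box_polys_def lookup_add intro: add_mono)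

lemma box_polys_one: "(1 :: (nat, 'c::comm_ring_1) mpoly) \<in> box_polys N d"
  by (simp add: box_polys_def state.one_mem)

lemma box_polys_power:
  fixes P :: "(nat, 'c::comm_ring_1) mpoly"
  shows "P \<in> box_polys N d \<Longrightarrow> P ^ k \<in> box_polys N (k * d)"
  by (induction k) (simp_all add: box_polys_one box_polys_mult)

lemma box_polys_prod:
  fixes f :: "'a \<Rightarrow> (nat, 'c::comm_ring_1) mpoly"
  shows "(\<And>x. x \<in> A \<Longrightarrow> f x \<in> box_polys N d) \<Longrightarrow> prod f A \<in> box_polys N (card A * d)"
  by (induction A rule: infinite_finite_induct) (simp_all add: box_polys_one box_polys_mult)

lemma ex_box_polys:
  assumes "finite A" "A \<subseteq> state_polys N"
  shows "\<exists>d. A \<subseteq> box_polys N d"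
  using assms
proof (induction rule: finite_induct)
  case (insert P A)
  \<comment> \<open>Restricting to the state variables makes this set of exponents finite; all other
    exponents are 0. The inserted 0 keeps \<open>Max\<close> meaningful when the set is
    empty.\<close>
  let ?E = "(\<lambda>(m, i). Poly_Mapping.lookup m i) ` (Poly_Mapping.keys P \<times> {1..N})"
  have "Poly_Mapping.lookup m i \<le> Max (insert 0 ?E)" if m: "m \<in> Poly_Mapping.keys P" for m i
  proof (cases "i \<in> {1..N}")
    case True
    with m show ?thesis by (intro Max_ge) auto
  next
    case False
    with m insert.prems have "i \<notin> Poly_Mapping.keys m"
      by (auto simp: state_polys_def indets_def)
    then show ?thesis by (simp add: in_keys_iff)
  qed
  then have P: "P \<in> box_polys N (Max (insert 0 ?E))"
    using insert.prems by (simp add: box_polys_def)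
  obtain d where "A \<subseteq> box_polys N d" using insert by auto
  then show ?case
    using P box_polys_mono[of d "max d (Max (insert 0 ?E))" N]
      box_polys_mono[of "Max (insert 0 ?E)" "max d (Max (insert 0 ?E))" N]
    by (intro exI[of _ "max d (Max (insert 0 ?E))"]) auto
qed auto

definition box_monomials :: "nat \<Rightarrow> nat \<Rightarrow> (nat \<Rightarrow>\<^sub>0 nat) set" where
  "box_monomials N d = {m. Poly_Mapping.keys m \<subseteq> {1..N} \<and> (\<forall>i. Poly_Mapping.lookup m i \<le> d)}"

text \<open>A monomial in the box is determined by its \<open>N\<close> exponents, each with
  \<open>Suc d\<close> possible values.\<close>

lemma box_monomials_finite_card:
  "finite (box_monomials N d) \<and> card (box_monomials N d) \<le> Suc d ^ N"
proof -
  let ?g = "\<lambda>m. restrict (Poly_Mapping.lookup m) {1..N}"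
  let ?E = "PiE {1..N} (\<lambda>_. {0..d})"
  have inj: "inj_on ?g (box_monomials N d)"
  proof (rule inj_onI, rule poly_mapping_eqI)
    fix m m' i
    assume m: "m \<in> box_monomials N d" "m' \<in> box_monomials N d" "?g m = ?g m'"
    show "Poly_Mapping.lookup m i = Poly_Mapping.lookup m' i"
    proof (cases "i \<in> {1..N}")
      case True
      then show ?thesis using m(3) by (metis restrict_apply')
    next
      case False
      then have "i \<notin> Poly_Mapping.keys m" "i \<notin> Poly_Mapping.keys m'"
        using m by (auto simp: box_monomials_def)
      then show ?thesis by (simp add: in_keys_iff)
    qed
  qed
  have sub: "?g ` box_monomials N d \<subseteq> ?E" by (auto simp: box_monomials_def)
  have fin: "finite ?E" by (intro finite_PiE) auto
  have "card ?E = Suc d ^ N" by (simp add: card_PiE)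
  then show ?thesis
    using card_inj_on_le[OF inj sub fin] inj_on_finite[OF inj sub fin] by simp
qed

lemma box_polys_keys: "P \<in> box_polys N d \<Longrightarrow> Poly_Mapping.keys P \<subseteq> box_monomials N d"
  by (auto simp: box_polys_def box_monomials_def state_polys_def indets_def)

text \<open>Comparing coefficients gives one linear equation for each monomial of the box, and there
  are fewer of these than unknowns.\<close>

lemma box_polys_dependent:
  fixes V :: "'a \<Rightarrow> (nat, 'c::field) mpoly"
  assumes "finite A" "Suc d ^ N < card A" "\<And>x. x \<in> A \<Longrightarrow> V x \<in> box_polys N d"
  shows "\<exists>c. (\<exists>x\<in>A. c x \<noteq> 0) \<and> (\<Sum>x\<in>A. Const (c x) * V x) = 0"
proof -
  obtain c where c: "\<exists>x\<in>A. c x \<noteq> 0"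
    "\<And>m. m \<in> box_monomials N d \<Longrightarrow> (\<Sum>x\<in>A. c x * Poly_Mapping.lookup (V x) m) = 0"
    using underdetermined_system[of "box_monomials N d" A "\<lambda>m x. Poly_Mapping.lookup (V x) m"]
      box_monomials_finite_card[of N d] assms by auto
  have "Poly_Mapping.lookup (\<Sum>x\<in>A. Const (c x) * V x) m = 0" for m
  proof (cases "m \<in> box_monomials N d")
    case True
    then show ?thesis by (simp add: lookup_sum lookup_Const_mult c(2))
  next
    case False
    then have "Poly_Mapping.lookup (V x) m = 0" if "x \<in> A" for x
      using box_polys_keys[OF assms(3)[OF that]] by (auto simp: in_keys_iff)
    then show ?thesis by (simp add: lookup_sum lookup_Const_mult)
  qed
  then have "(\<Sum>x\<in>A. Const (c x) * V x) = 0"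
    by (intro poly_mapping_eqI) simp
  with c(1) show ?thesis by blast
qed

text \<open>The summands are the monomials in the \<open>N + 1\<close> fractions
  \<open>R j / S\<close> with all exponents at most \<open>D\<close>, cleared by the common
  denominator \<open>S ^ (D * Suc N)\<close>.\<close>

lemma fractions_dependent:
  fixes R :: "nat \<Rightarrow> (nat, 'c::field) mpoly"
  assumes S: "S \<in> state_polys N" and R: "\<And>j. j \<le> N \<Longrightarrow> R j \<in> state_polys N"
  shows "\<exists>D c. (\<exists>\<beta>\<in>PiE {..N} (\<lambda>_. {..D}). c \<beta> \<noteq> 0) \<and>
    (\<Sum>\<beta>\<in>PiE {..N} (\<lambda>_. {..D}). Const (c \<beta>) * (\<Prod>j\<le>N. S ^ (D - \<beta> j) * R j ^ \<beta> j)) = 0"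
proof -
  have "insert S (R ` {..N}) \<subseteq> state_polys N" using S R by auto
  then obtain d where d: "insert S (R ` {..N}) \<subseteq> box_polys N d"
    using ex_box_polys[of "insert S (R ` {..N})" N] by auto
  \<comment> \<open>The numerators lie in the box of bound \<open>Suc N * (D * d)\<close>, which has
    at most \<open>Suc D ^ N * Suc (Suc N * d) ^ N\<close> monomials. With this \<open>D\<close> the
    second factor is \<open>D\<close> itself, which is below \<open>Suc D\<close>, so the
    \<open>Suc D ^ Suc N\<close> exponent vectors outnumber the monomials.\<close>
  define D where "D = Suc (Suc N * d) ^ N"
  let ?A = "PiE {..N} (\<lambda>_. {..D})"
  let ?V = "\<lambda>\<beta>. \<Prod>j\<le>N. S ^ (D - \<beta> j) * R j ^ \<beta> j"
  have V: "?V \<beta> \<in> box_polys N (Suc N * (D * d))" if \<beta>: "\<beta> \<in> ?A" for \<beta>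
  proof -
    have "S ^ (D - \<beta> j) * R j ^ \<beta> j \<in> box_polys N (D * d)" if "j \<le> N" for j
    proof -
      have "\<beta> j \<le> D" using \<beta> that by (auto simp: PiE_iff)
      then have "(D - \<beta> j) * d + \<beta> j * d = D * d" by (simp flip: distrib_right)
      moreover have "S ^ (D - \<beta> j) * R j ^ \<beta> j \<in> box_polys N ((D - \<beta> j) * d + \<beta> j * d)"
        using d that by (intro box_polys_mult box_polys_power) auto
      ultimately show ?thesis by simp
    qed
    then show ?thesis
      using box_polys_prod[of "{..N}" "\<lambda>j. S ^ (D - \<beta> j) * R j ^ \<beta> j" N "D * d"] by simp
  qed
  have "Suc (Suc N * (D * d)) \<le> Suc D * Suc (Suc N * d)" by (simp add: algebra_simps)
  then have "Suc (Suc N * (D * d)) ^ N \<le> Suc D ^ N * D"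
    unfolding D_def by (metis power_mono power_mult_distrib zero_le)
  also have "\<dots> < Suc D ^ Suc N" by simp
  also have "\<dots> = card ?A" by (simp add: card_PiE)
  finally have "Suc (Suc N * (D * d)) ^ N < card ?A" .
  then show ?thesis
    using box_polys_dependent[of ?A "Suc N * (D * d)" N ?V] V by (auto intro: finite_PiE)
qed


subsection \<open>The derived polynomial\<close>

lemma keys_sum_single: "Poly_Mapping.keys (\<Sum>x\<in>A. Poly_Mapping.single (f x) (g x)) \<subseteq> f ` A"
proof (induction A rule: infinite_finite_induct)
  case (insert x A)
  then show ?case
    using keys_add[of "Poly_Mapping.single (f x) (g x)" "\<Sum>x\<in>A. Poly_Mapping.single (f x) (g x)"]
    by (auto split: if_splits)
qed simp_all

text \<open>Injectivity of \<open>f\<close> prevents cancellation, so the coefficient at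
  \<open>f x\<close> is exactly \<open>c x\<close>.\<close>

lemma sum_single_nonzero:
  assumes "finite A" "inj_on f A" "x \<in> A" "c x \<noteq> 0"
  shows "(\<Sum>x\<in>A. Poly_Mapping.single (f x) (c x)) \<noteq> 0"
proof -
  have "Poly_Mapping.lookup (\<Sum>y\<in>A. Poly_Mapping.single (f y) (c y)) (f x) =
      (\<Sum>y\<in>A. if y = x then c y else 0)"
    unfolding lookup_sum
    by (rule sum.cong) (use assms in \<open>auto simp: lookup_single when_def inj_on_def\<close>)
  also have "\<dots> = c x" using assms by simp
  finally show ?thesis using assms(4) by auto
qed

context model_with_denominator
begin

lemma congruent_prod:
  assumes "\<And>x. x \<in> A \<Longrightarrow> f x - g x \<in> J" "\<And>x. x \<in> A \<Longrightarrow> f x \<in> ring" "\<And>x. x \<in> A \<Longrightarrow> g x \<in> ring"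
  shows "prod f A - prod g A \<in> J"
  using assms
  by (induction A rule: infinite_finite_induct)
    (simp_all add: J_zero congruent_mult model.prod_mem)

lemma congruent_power:
  assumes "a - b \<in> J" "a \<in> ring" "b \<in> ring" shows "a ^ k - b ^ k \<in> J"
  using congruent_prod[of "{..<k}" "\<lambda>_. a" "\<lambda>_. b"] assms by simp

text \<open>Only finitely many derivatives are involved, so the largest of their exponents serves
  for all of them.\<close>

lemma common_reduction:
  "\<exists>e R. (\<forall>j\<le>n. R j \<in> state_polys (dim M) \<and> q ^ e * Var (W, j) - lift_state (R j) \<in> J)"
proof -
  have "\<forall>j. \<exists>k R. R \<in> state_polys (dim M) \<and> q ^ k * Var (W, j) - lift_state R \<in> J"
    using output_derivative_reducible unfolding reducible_def by blast
  then obtain k R where kR: "R j \<in> state_polys (dim M)" "q ^ k j * Var (W, j) - lift_state (R j) \<in> J" for j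
    by metis
  let ?e = "Max (k ` {..n})"
  have "q ^ ?e * Var (W, j) - lift_state (Q ^ (?e - k j) * R j) \<in> J" if "j \<le> n" for j
    using that by (intro reducible_mono kR) auto
  moreover have "Q ^ (?e - k j) * R j \<in> state_polys (dim M)" for j
    using kR Q_state by (intro state.mult_mem state.power_mem)
  ultimately show ?thesis
    by (intro exI[of _ ?e] exI[of _ "\<lambda>j. Q ^ (?e - k j) * R j"]) blast
qed

text \<open>The dependency between the fractions representing the derivatives of the output is read
  as a polynomial in these derivatives. It vanishes modulo \<open>J\<close> up to a power of
  \<open>q\<close>, which is what the saturation permits.\<close>

lemma derived_poly_with_order:
  "\<exists>P\<in>derived_polys M Q. P \<noteq> 0 \<and> (\<exists>k\<le>dim M. has_order P k)"
proof -
  let ?N = "dim M"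
  obtain e R where R: "\<And>j. j \<le> ?N \<Longrightarrow> R j \<in> state_polys ?N"
    "\<And>j. j \<le> ?N \<Longrightarrow> q ^ e * Var (W, j) - lift_state (R j) \<in> J"
    using common_reduction[of ?N] by blast
  define S where "S = Q ^ e"
  have S: "S \<in> state_polys ?N" by (simp add: S_def state.power_mem Q_state)
  let ?s = "lift_state S"
  have s: "?s = q ^ e" "?s \<in> ring" by (simp_all add: S_def lift_hom.hom_power model.power_mem q_in_ring)
  obtain D c where c: "\<exists>\<beta>\<in>PiE {..?N} (\<lambda>_. {..D}). c \<beta> \<noteq> 0"
    "(\<Sum>\<beta>\<in>PiE {..?N} (\<lambda>_. {..D}). Const (c \<beta>) * (\<Prod>j\<le>?N. S ^ (D - \<beta> j) * R j ^ \<beta> j)) = 0"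
    using fractions_dependent[of S ?N R, OF S R(1)] by blast
  let ?A = "PiE {..?N} (\<lambda>_. {..D})"
  have finA: "finite ?A" by (intro finite_PiE) auto
  define V where "V \<beta> = (\<Prod>j\<le>?N. S ^ (D - \<beta> j) * R j ^ \<beta> j)" for \<beta> :: "nat \<Rightarrow> nat"
  define w where "w \<beta> = (\<Prod>j\<le>?N. Var (W, j) ^ \<beta> j :: (indeterminate, 'k poly fract) dpoly)"
    for \<beta> :: "nat \<Rightarrow> nat"
  \<comment> \<open>Each of the \<open>Suc ?N\<close> factors of \<open>w \<beta>\<close> consumes
    \<open>?s ^ D\<close>, whatever its exponent \<open>\<beta> j\<close>.\<close>
  define K where "K = D * Suc ?N"
  have reduce: "?s ^ K * w \<beta> - lift_state (V \<beta>) \<in> J" if \<beta>: "\<beta> \<in> ?A" for \<beta>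
  proof -
    have "?s ^ D * Var (W, j) ^ \<beta> j - lift_state (S ^ (D - \<beta> j) * R j ^ \<beta> j) \<in> J" if j: "j \<le> ?N" for j
    proof -
      have "\<beta> j \<le> D" using \<beta> j by (auto simp: PiE_iff)
      then have "?s ^ D = ?s ^ (D - \<beta> j) * ?s ^ \<beta> j" by (simp flip: power_add)
      then have "?s ^ D * Var (W, j) ^ \<beta> j - lift_state (S ^ (D - \<beta> j) * R j ^ \<beta> j) =
          ?s ^ (D - \<beta> j) * ((?s * Var (W, j)) ^ \<beta> j - lift_state (R j) ^ \<beta> j)"
        by (simp add: lift_hom.hom_mult lift_hom.hom_power power_mult_distrib right_diff_distrib mult.assoc)
      also have "\<dots> \<in> J"
        using R[OF j] s S
        by (intro J_mult congruent_power model.power_mem model.mult_mem W_in_model_ring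
            lift_state_in_model_ring) simp_all
      finally show ?thesis .
    qed
    moreover have "S ^ (D - \<beta> j) * R j ^ \<beta> j \<in> state_polys ?N" if "j \<le> ?N" for j
      using S R(1)[OF that] by (intro state.mult_mem state.power_mem)
    ultimately have "(\<Prod>j\<le>?N. ?s ^ D * Var (W, j) ^ \<beta> j) -
        (\<Prod>j\<le>?N. lift_state (S ^ (D - \<beta> j) * R j ^ \<beta> j)) \<in> J"
      using s(2) S
      by (intro congruent_prod model.mult_mem model.power_mem W_in_model_ring lift_state_in_model_ring)
        auto
    then show ?thesis
      unfolding w_def V_def K_def lift_hom.hom_prod power_mult
      by (simp only: prod.distrib prod_constant card_atMost)
  qed
  define P where "P = (\<Sum>\<beta>\<in>?A. Const (c \<beta>) * w \<beta>)"
  \<comment> \<open>The dependency makes the lifted sum zero; inserting it lets the monomialwise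
    congruences \<open>reduce\<close> be summed.\<close>
  have "?s ^ K * P - 0 = ?s ^ K * P - lift_state (\<Sum>\<beta>\<in>?A. Const (c \<beta>) * V \<beta>)"
    using c(2) by (simp add: V_def lift_hom.hom_0)
  also have "\<dots> = (\<Sum>\<beta>\<in>?A. Const (c \<beta>) * (?s ^ K * w \<beta> - lift_state (V \<beta>)))"
    by (simp add: P_def lift_hom.hom_sum lift_hom.hom_mult lift_state_Const sum_distrib_left
        sum_subtractf right_diff_distrib mult.left_commute)
  also have "\<dots> \<in> J"
    unfolding diff_ideal_gen_def
    by (intro model.ideal_gen_sum model.ideal_gen_mult Const_in_model_ring
        reduce[unfolded diff_ideal_gen_def])
  finally have PJ: "q ^ (e * K) * P \<in> J" by (simp add: s(1) power_mult)
  \<comment> \<open>Multiplying by \<open>w\<close> makes the relation non-constant without having to know that the ideal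
    is proper.\<close>
  define P' where "P' = Var (W, 0) * P"
  \<comment> \<open>The exponent vector of \<open>Var (W, 0) * w \<beta>\<close>; the extra factor
    shifts only the exponent at \<open>j = 0\<close>.\<close>
  define \<mu> where "\<mu> \<beta> = Poly_Mapping.single (W, 0) 1 + (\<Sum>j\<le>?N. Poly_Mapping.single (W, j) (\<beta> j))"
    for \<beta> :: "nat \<Rightarrow> nat"
  have P'_eq: "P' = (\<Sum>\<beta>\<in>?A. Poly_Mapping.single (\<mu> \<beta>) (c \<beta>))"
    unfolding P'_def P_def w_def \<mu>_def Var_power prod_single sum_distrib_left
    by (simp add: Const_def Var_def mult_single)
  have \<mu>_lookup: "Poly_Mapping.lookup (\<mu> \<beta>) (W, j) = \<beta> j + (if j = 0 then 1 else 0)" if "j \<le> ?N" for \<beta> j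
    using that by (simp add: \<mu>_def lookup_add lookup_sum lookup_single when_def)
  have "inj_on \<mu> ?A"
  proof (rule inj_onI)
    fix \<beta> \<gamma> assume A: "\<beta> \<in> ?A" "\<gamma> \<in> ?A" "\<mu> \<beta> = \<mu> \<gamma>"
    have "\<beta> j = \<gamma> j" if "j \<in> {..?N}" for j
      using \<mu>_lookup[of j \<beta>] \<mu>_lookup[of j \<gamma>] A(3) that by simp
    \<comment> \<open>Outside \<open>{..?N}\<close> both functions take the default value of
      \<open>PiE\<close>, so agreement on the exponents suffices.\<close>
    then show "\<beta> = \<gamma>" using A by (intro PiE_ext) auto
  qed
  with c(1) have nz: "P' \<noteq> 0"
    unfolding P'_eq using sum_single_nonzero[OF finA] by blast
  have keys: "Poly_Mapping.keys (\<mu> \<beta>) \<subseteq> {W} \<times> {..?N}" for \<beta>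
    unfolding \<mu>_def
    by (rule subset_trans[OF keys_add Un_least])
      (use keys_sum_single[of "\<lambda>j. (W, j)" \<beta> "{..?N}"] in auto)
  have ind: "indets P' \<subseteq> {W} \<times> {..?N}"
    unfolding P'_eq
    by (intro subset_trans[OF indets_sum] UN_least subset_trans[OF indets_single] keys)
  have "indets P' \<noteq> {}"
  proof -
    obtain m where m: "m \<in> Poly_Mapping.keys P'"
      using nz by (metis in_keys_iff lookup_zero poly_mapping_eqI)
    then obtain \<beta> where "m = \<mu> \<beta>"
      unfolding P'_eq using keys_sum_single[of \<mu> c ?A] by blast
    \<comment> \<open>The extra factor gives this variable an exponent of at least 1 in every
      monomial, so \<open>P'\<close> has an order.\<close>
    then have "(W, 0) \<in> Poly_Mapping.keys m"
      using \<mu>_lookup[of 0 \<beta>] by (simp add: in_keys_iff)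
    with m show ?thesis unfolding indets_def by blast
  qed
  moreover have fin: "finite (indets P')" by (simp add: indets_def)
  ultimately have "has_order P' (Max (snd ` indets P'))"
    by (auto simp: has_order_def intro: Max_in)
  moreover have "Max (snd ` indets P') \<le> ?N"
    using ind fin \<open>indets P' \<noteq> {}\<close> by (subst Max_le_iff) auto
  moreover have "P' \<in> derived_polys M Q"
  proof -
    have "q ^ (e * K) * P' \<in> J"
      using J_mult[OF W_in_model_ring PJ] by (simp add: P'_def mult.left_commute)
    moreover have "P' \<in> ring" using ind by (auto simp: model_ring_alt)
    ultimately show ?thesis
      using ind by (auto simp: derived_polys_def model_ideal_def saturation_def)
  qed
  ultimately show ?thesis using nz by blast
qed

end

theorem proposition4p9:
  fixes p q :: "(unit, 'k::field_char_0 poly fract) dpoly"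
    and F :: "'k poly fract set"
    and n m :: nat
    and \<alpha> :: arith_op
    and Q :: "(nat, 'k poly fract) mpoly"
  assumes "F = {Fract c 1 | c. True} \<or> F = UNIV"
    and "coeffs_in F p" and "coeffs_in F q"
    and "lho p n" and "lho q m"
    and "\<alpha> = Div \<Longrightarrow> m = 0 \<Longrightarrow> solved_rhs n q m \<noteq> 0"
    and "common_denominator (op_model \<alpha> p n q m) Q"
  shows "(\<exists>P \<in> derived_polys (op_model \<alpha> p n q m) Q. P \<noteq> 0)
       \<and> min_order (op_model \<alpha> p n q m) Q \<le> enat (m + n)"
proof -
  let ?M = "op_model \<alpha> p n q m"
  interpret model_with_denominator ?M Q
    by unfold_locales (rule assms(7))
  obtain P k where P: "P \<in> derived_polys ?M Q" "P \<noteq> 0" "k \<le> dim ?M" "has_order P k"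
    using derived_poly_with_order by blast
  have "min_order ?M Q \<le> enat k"
    unfolding min_order_def by (rule Inf_lower) (use P in blast)
  also have "\<dots> \<le> enat (m + n)"
    \<comment> \<open>The model has one state variable for each derivative below the two orders, so
      its dimension is \<open>n + m\<close>.\<close>
    using P(3) by (simp add: op_model_def)
  finally show ?thesis using P by blast
qed

end
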